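(* Let $\kappa$ be a cardinal, let $U$ be a $\kappa$-complete $p$-point ultrafilter over $\kappa$, and for each $\alpha<\kappa$ let $U_\alpha$ be a $\kappa$-complete $p$-point ultrafilter over $\kappa$. Suppose $W$ is an ultrafilter with $W\equiv_{RK}\sum_U U_\alpha$. Then $W$ has the Galvin property: for every sequence $\langle A_i\mid i<\kappa^+\rangle$ of members of $W$ there is $I\in[\kappa^+]^{\kappa}$ with $\bigcap_{i\in I}A_i\in W$.
   Context: An ultrafilter $U$ over an ordinal $\delta$ is a $p$-point if for every function $f:\delta\to\delta$ which is not constant mod $U$ there is $X\in U$ such that $f^{-1}[\gamma]\cap X$ is bounded in $\delta$ for every $\gamma<\delta$. For an ultrafilter $U$ over $\kappa$ and ultrafilters $U_\alpha$ ($\alpha<\kappa$), $U_\alpha$ over $\delta_\alpha\le\kappa$, the $U$-sum $\sum_U U_\alpha$ is the ultrafilter over $\kappa\times\kappa$ given by: $X\in\sum_U U_\alpha$ iff $\{\alpha<\kappa\mid (X)_\alpha\in U_\alpha\}\in U$, where $(X)_\alpha=\{\beta<\delta_\alpha\mid\langle\alpha,\beta\rangle\in X\}$. For ultrafilters $U$ over $Y$ and $W$ over $X$, $U\le_{RK}W$ means there is $\pi:X\to Y$ with $U=\{B\subseteq Y\mid \pi^{-1}[B]\in W\}$; $U\equiv_{RK}W$ means $U\le_{RK}W$ and $W\le_{RK}U$. *)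

theory Defs
  imports Main
begin

unbundle cardinal_syntax

text \<open>
  An ordinal \<open>\<delta>\<close> is represented by a (reflexive) well-order relation \<open>r\<close>, a cardinal by a relation
  with \<open>Card_order r\<close>. The ordinals below \<open>\<delta>\<close> are the elements of \<open>Field r\<close>, and \<open>underS r \<gamma>\<close> is
  the set of ordinals below \<open>\<gamma>\<close>. Ultrafilters are proper, but may be principal.
\<close>

definition ultrafilter_over :: "'a set \<Rightarrow> 'a set set \<Rightarrow> bool" where
  "ultrafilter_over X U \<longleftrightarrow>
     U \<subseteq> Pow X \<and> X \<in> U \<and> {} \<notin> U \<and>
     (\<forall>A\<in>U. \<forall>B\<in>U. A \<inter> B \<in> U) \<and>
     (\<forall>A\<in>U. \<forall>B. A \<subseteq> B \<and> B \<subseteq> X \<longrightarrow> B \<in> U) \<and>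
     (\<forall>A. A \<subseteq> X \<longrightarrow> A \<in> U \<or> X - A \<in> U)"

definition complete_filter :: "'k rel \<Rightarrow> 'a set set \<Rightarrow> bool" where
  "complete_filter \<kappa> U \<longleftrightarrow> (\<forall>\<A>. \<A> \<subseteq> U \<and> \<A> \<noteq> {} \<and> |\<A>| <o \<kappa> \<longrightarrow> \<Inter>\<A> \<in> U)"

definition bounded_in :: "'a rel \<Rightarrow> 'a set \<Rightarrow> bool" where
  "bounded_in r S \<longleftrightarrow> (\<exists>\<beta>\<in>Field r. S \<subseteq> underS r \<beta>)"

definition constant_mod :: "'a set \<Rightarrow> 'a set set \<Rightarrow> ('a \<Rightarrow> 'b) \<Rightarrow> bool" where
  "constant_mod X U f \<longleftrightarrow> (\<exists>c. {x \<in> X. f x = c} \<in> U)"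

definition p_point :: "'a rel \<Rightarrow> 'a set set \<Rightarrow> bool" where
  "p_point r U \<longleftrightarrow>
     ultrafilter_over (Field r) U \<and>
     (\<forall>f. f ` Field r \<subseteq> Field r \<and> \<not> constant_mod (Field r) U f \<longrightarrow>
        (\<exists>X\<in>U. \<forall>\<gamma>\<in>Field r. bounded_in r (f -` underS r \<gamma> \<inter> X)))"

text \<open>
  The sum is taken over index set \<open>K\<close>, where \<open>V \<alpha>\<close> is an ultrafilter over \<open>D \<alpha> \<subseteq> K\<close>.
\<close>

definition ultrafilter_sum ::
    "'a set \<Rightarrow> 'a set set \<Rightarrow> ('a \<Rightarrow> 'a set) \<Rightarrow> ('a \<Rightarrow> 'a set set) \<Rightarrow> ('a \<times> 'a) set set" where
  "ultrafilter_sum K U D V =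
     {X. X \<subseteq> K \<times> K \<and> {\<alpha> \<in> K. {\<beta> \<in> D \<alpha>. (\<alpha>, \<beta>) \<in> X} \<in> V \<alpha>} \<in> U}"

definition RK_le :: "'b set \<Rightarrow> 'b set set \<Rightarrow> 'a set \<Rightarrow> 'a set set \<Rightarrow> bool" where
  "RK_le Y U X W \<longleftrightarrow>
     (\<exists>\<pi>. \<pi> ` X \<subseteq> Y \<and> U = {B. B \<subseteq> Y \<and> {x \<in> X. \<pi> x \<in> B} \<in> W})"

definition RK_equiv :: "'b set \<Rightarrow> 'b set set \<Rightarrow> 'a set \<Rightarrow> 'a set set \<Rightarrow> bool" where
  "RK_equiv Y U X W \<longleftrightarrow> RK_le Y U X W \<and> RK_le X W Y U"

definition galvin_property :: "'k rel \<Rightarrow> 'a set set \<Rightarrow> bool" where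
  "galvin_property \<kappa> W \<longleftrightarrow>
     (\<forall>A. (\<forall>i\<in>Field (cardSuc \<kappa>). A i \<in> W) \<longrightarrow>
        (\<exists>I. I \<subseteq> Field (cardSuc \<kappa>) \<and> |I| =o \<kappa> \<and> (\<Inter>i\<in>I. A i) \<in> W))"

end

theory Submission
  imports Defs
begin

text \<open>
  If \<open>U\<close> or some \<open>V \<alpha>\<close> is nonprincipal, then \<open>\<kappa>\<close> is regular and \<open>2\<^sup>\<lambda> \<le> \<kappa>\<close> for \<open>\<lambda> < \<kappa>\<close>; otherwise the
  sum is principal. In the first case let \<open>B i\<close> be the set of all \<open>\<alpha>\<close> such that the section of \<open>A i\<close> at
  \<open>\<alpha>\<close> is in \<open>V \<alpha>\<close>. By pigeonhole there are \<open>i\<close> and an injective sequence \<open>j\<close> of indices such that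
  \<open>A (j \<gamma>)\<close> agrees with \<open>A i\<close> on \<open>\<gamma> \<times> \<gamma>\<close>, and \<open>B (j \<gamma>)\<close> with \<open>B i\<close> on \<open>\<gamma>\<close>. The p-points provide
  \<open>X \<in> U\<close> and \<open>Y \<alpha> \<in> V \<alpha>\<close> for \<open>\<alpha> \<in> B i\<close>, and regularity a function \<open>G\<close> on \<open>\<kappa>\<close>, such that
  \<open>X - B (j \<gamma>) \<subseteq> G \<gamma>\<close>, and \<open>Y \<alpha>\<close> minus the section of \<open>A (j \<gamma>)\<close> at \<open>\<alpha>\<close> is a subset of \<open>G \<gamma>\<close>
  whenever \<open>\<alpha> < \<gamma>\<close>. Hence only coordinates in the interval \<open>[\<gamma>, G \<gamma>)\<close> obstruct membership in
  \<open>A (j \<gamma>)\<close>, apart from the pairs with \<open>\<gamma> \<le> \<alpha>\<close>, for which completeness of \<open>V \<alpha>\<close> suffices. Choose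
  \<open>\<kappa>\<close> many \<open>\<gamma>\<close> with disjoint intervals and split them into three classes of size \<open>\<kappa>\<close>: for one of the
  classes the union of the intervals is neither in \<open>U\<close> nor in \<open>V \<alpha>\<close> for \<open>U\<close>-almost all \<open>\<alpha>\<close>.
\<close>

section \<open>Ultrafilters, and the cardinals that carry a nonprincipal complete one\<close>

lemma ultrafilter_subset: "ultrafilter_over X U \<Longrightarrow> A \<in> U \<Longrightarrow> A \<subseteq> X"
  and ultrafilter_space: "ultrafilter_over X U \<Longrightarrow> X \<in> U"
  and ultrafilter_empty: "ultrafilter_over X U \<Longrightarrow> {} \<notin> U"
  and ultrafilter_Int: "ultrafilter_over X U \<Longrightarrow> A \<in> U \<Longrightarrow> B \<in> U \<Longrightarrow> A \<inter> B \<in> U"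
  and ultrafilter_mono: "ultrafilter_over X U \<Longrightarrow> A \<in> U \<Longrightarrow> A \<subseteq> B \<Longrightarrow> B \<subseteq> X \<Longrightarrow> B \<in> U"
  and ultrafilter_cases: "ultrafilter_over X U \<Longrightarrow> A \<subseteq> X \<Longrightarrow> A \<in> U \<or> X - A \<in> U"
  unfolding ultrafilter_over_def by auto

lemma ultrafilter_disjoint:
  assumes "ultrafilter_over X U" "A \<in> U" "A \<inter> B = {}"
  shows "B \<notin> U"
  using ultrafilter_Int[OF assms(1,2), of B] ultrafilter_empty[OF assms(1)] assms(3) by auto

text \<open>Intersecting with \<open>X\<close> covers the empty index set, about which
  \<open>complete_filter\<close> says nothing and whose intersection would be
  \<open>UNIV\<close>.\<close>

lemma complete_filter_INT:
  assumes "ultrafilter_over X U" "complete_filter \<kappa> U" "|S| <o \<kappa>" "\<And>s. s \<in> S \<Longrightarrow> F s \<in> U"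
  shows "X \<inter> (\<Inter>s\<in>S. F s) \<in> U"
proof (cases "S = {}")
  case True
  then show ?thesis using ultrafilter_space[OF assms(1)] by simp
next
  case False
  have "|F ` S| <o \<kappa>" using card_of_image assms(3) by (rule ordLeq_ordLess_trans)
  with False assms(2,4) have "(\<Inter>s\<in>S. F s) \<in> U"
    unfolding complete_filter_def by (metis image_is_empty image_subsetI)
  with assms(1) show ?thesis by (metis ultrafilter_Int ultrafilter_space)
qed

text \<open>\<open>small_image_bounded\<close> is regularity. \<open>Pow_ordLeq\<close> bounds power
  sets by \<le> only, so \<omega> qualifies, and under CH so does the first uncountable cardinal.
  This bound is what counting traces in the pigeonhole argument requires.\<close>

locale strong_limit_regular =
  fixes \<kappa> :: "'a rel"
  assumes card: "Card_order \<kappa>"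
    and infinite: "infinite (Field \<kappa>)"
    and small_image_bounded:
      "\<And>S h. S \<subseteq> Field \<kappa> \<Longrightarrow> |S| <o \<kappa> \<Longrightarrow> h ` S \<subseteq> Field \<kappa> \<Longrightarrow> bounded_in \<kappa> (h ` S)"
    and Pow_ordLeq: "\<And>S. S \<subseteq> Field \<kappa> \<Longrightarrow> |S| <o \<kappa> \<Longrightarrow> |Pow S| \<le>o \<kappa>"

text \<open>A nonprincipal complete ultrafilter contains no set of size below \<kappa>. If \<kappa>
  were finite, singular or had too large a power set below it, then \<open>U\<close> would contain a
  small set, the empty set or a singleton.\<close>

lemma nonprincipal_imp_strong_limit_regular:
  fixes \<kappa> :: "'a rel"
  assumes card: "Card_order \<kappa>" and U: "ultrafilter_over (Field \<kappa>) U" "complete_filter \<kappa> U"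
    and nonprincipal: "\<And>x. {x} \<notin> U"
  shows "strong_limit_regular \<kappa>"
proof
  show "Card_order \<kappa>" by fact
  have small: "S \<notin> U" if "|S| <o \<kappa>" for S
  proof
    assume S: "S \<in> U"
    have "Field \<kappa> - {s} \<in> U" if "s \<in> S" for s
      using ultrafilter_cases[OF U(1), of "{s}"] nonprincipal ultrafilter_subset[OF U(1) S] that by auto
    from complete_filter_INT[OF U \<open>|S| <o \<kappa>\<close>, of "\<lambda>s. Field \<kappa> - {s}", OF this]
    have "Field \<kappa> \<inter> (\<Inter>s\<in>S. Field \<kappa> - {s}) \<in> U" .
    moreover have "S \<inter> (Field \<kappa> \<inter> (\<Inter>s\<in>S. Field \<kappa> - {s})) = {}" by blast
    ultimately show False using ultrafilter_disjoint[OF U(1) S] by blast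
  qed
  show inf: "infinite (Field \<kappa>)"
  proof
    assume fin: "finite (Field \<kappa>)"
    \<comment> \<open>For finite \<kappa>, already the complement of a point is small, so it is not
      in \<open>U\<close> and the singleton is.\<close>
    have "|Field \<kappa> - {x}| <o \<kappa>" if "x \<in> Field \<kappa>" for x
    proof -
      have "|Field \<kappa> - {x}| <o |Field \<kappa>|"
      proof (rule ccontr)
        assume "\<not> ?thesis"
        then have "|Field \<kappa>| \<le>o |Field \<kappa> - {x}|"
          using not_ordLess_iff_ordLeq card_of_Well_order by blast
        then obtain f where "inj_on f (Field \<kappa>)" "f ` Field \<kappa> \<subseteq> Field \<kappa> - {x}"
          unfolding card_of_ordLeq[symmetric] by blast
        then have "card (Field \<kappa>) \<le> card (Field \<kappa> - {x})" using fin by (intro card_inj_on_le) auto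
        with card_Diff1_less[OF fin that] show False by simp
      qed
      then show ?thesis using card_of_Field_ordIso[OF card] ordLess_ordIso_trans by blast
    qed
    moreover obtain x where "x \<in> Field \<kappa>"
      using ultrafilter_space[OF U(1)] ultrafilter_empty[OF U(1)] by fastforce
    ultimately show False
      using small ultrafilter_cases[OF U(1), of "{x}"] nonprincipal by auto
  qed
  show "bounded_in \<kappa> (h ` S)" if S: "|S| <o \<kappa>" and h: "h ` S \<subseteq> Field \<kappa>" for S and h :: "'a \<Rightarrow> 'a"
  proof (rule ccontr)
    assume unbounded: "\<not> bounded_in \<kappa> (h ` S)"
    have wo: "wo_rel \<kappa>" using card by (simp add: card_order_on_well_order_on wo_rel_def)
    \<comment> \<open>Each initial segment up to \<open>h s\<close> is small. If the values of
      \<open>h\<close> were unbounded, fewer than \<kappa> of these segments would cover \<kappa>,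
      so their complements would meet in the empty set.\<close>
    have "Field \<kappa> - under \<kappa> (h s) \<in> U" if "s \<in> S" for s
    proof -
      from that h have "h s \<in> Field \<kappa>" by auto
      then obtain b where b: "b \<in> Field \<kappa>" "h s \<noteq> b" "(h s, b) \<in> \<kappa>"
        using infinite_Card_order_limit[OF card inf] by blast
      then have "under \<kappa> (h s) \<subseteq> underS \<kappa> b"
        using wo_rel.TRANS[OF wo] wo_rel.ANTISYM[OF wo]
        unfolding under_def underS_def trans_def antisym_def by blast
      then have "|under \<kappa> (h s)| <o \<kappa>"
        using card_of_underS[OF card b(1)] card_of_mono1 ordLeq_ordLess_trans by blast
      with small ultrafilter_cases[OF U(1), of "under \<kappa> (h s)"] under_Field show ?thesis by metis
    qed
    from complete_filter_INT[OF U S this] have "Field \<kappa> \<inter> (\<Inter>s\<in>S. Field \<kappa> - under \<kappa> (h s)) \<in> U" .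
    moreover have "\<exists>s\<in>S. b \<in> under \<kappa> (h s)" if "b \<in> Field \<kappa>" for b
    proof -
      from unbounded that obtain s where s: "s \<in> S" "h s \<notin> underS \<kappa> b"
        unfolding bounded_in_def by blast
      with h that have "(b, h s) \<in> \<kappa>"
        using wo_rel.TOTALS[OF wo] wo_rel.REFL[OF wo] unfolding underS_def refl_on_def by blast
      with s(1) show ?thesis unfolding under_def by auto
    qed
    then have "Field \<kappa> \<inter> (\<Inter>s\<in>S. Field \<kappa> - under \<kappa> (h s)) = {}" by blast
    ultimately show False using ultrafilter_empty[OF U(1)] by simp
  qed
  show "|Pow S| \<le>o \<kappa>" if S: "|S| <o \<kappa>" for S :: "'a set"
  proof (rule ccontr)
    assume "\<not> |Pow S| \<le>o \<kappa>"
    then have "\<kappa> \<le>o |Pow S|"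
      using card card_of_Card_order by (metis card_order_on_well_order_on ordLeq_total)
    then have "|Field \<kappa>| \<le>o |Pow S|"
      using card_of_Field_ordIso[OF card] ordIso_ordLeq_trans by blast
    then obtain e where e: "inj_on e (Field \<kappa>)" "e ` Field \<kappa> \<subseteq> Pow S"
      unfolding card_of_ordLeq[symmetric] by blast
    \<comment> \<open>Points of \<kappa> are coded by subsets of \<open>S\<close>, and
      \<open>F s\<close> fixes the bit at \<open>s\<close> that \<open>U\<close> prefers. Points in
      all \<open>F s\<close> have the same code, so there is at most one.\<close>
    define F where "F s = (if {x \<in> Field \<kappa>. s \<in> e x} \<in> U then {x \<in> Field \<kappa>. s \<in> e x}
      else {x \<in> Field \<kappa>. s \<notin> e x})" for s
    have "F s \<in> U" for s
    proof -
      have "Field \<kappa> - {x \<in> Field \<kappa>. s \<in> e x} = {x \<in> Field \<kappa>. s \<notin> e x}" by auto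
      with ultrafilter_cases[OF U(1), of "{x \<in> Field \<kappa>. s \<in> e x}"] show ?thesis
        unfolding F_def by auto
    qed
    from complete_filter_INT[OF U S this] have *: "Field \<kappa> \<inter> \<Inter> (F ` S) \<in> U" .
    have "x = y" if xy: "x \<in> Field \<kappa> \<inter> \<Inter> (F ` S)" "y \<in> Field \<kappa> \<inter> \<Inter> (F ` S)" for x y
    proof -
      have "s \<in> e x \<longleftrightarrow> s \<in> e y" if "s \<in> S" for s
      proof -
        have "x \<in> F s" "y \<in> F s" using xy that by blast+
        then show ?thesis unfolding F_def by (cases "{x \<in> Field \<kappa>. s \<in> e x} \<in> U") simp_all
      qed
      moreover have "e x \<subseteq> S" "e y \<subseteq> S" using e(2) xy by blast+
      ultimately have "e x = e y" by blast
      then show ?thesis using inj_onD[OF e(1)] xy by blast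
    qed
    then have "Field \<kappa> \<inter> \<Inter> (F ` S) = {} \<or> (\<exists>x. Field \<kappa> \<inter> \<Inter> (F ` S) = {x})" by blast
    with * nonprincipal ultrafilter_empty[OF U(1)] show False by auto
  qed
qed

section \<open>Order and cardinal combinatorics below \<kappa>\<close>

context strong_limit_regular
begin

lemma wo: "wo_rel \<kappa>"
  using card by (simp add: card_order_on_well_order_on wo_rel_def)

lemma not_underS: "a \<in> Field \<kappa> \<Longrightarrow> b \<in> Field \<kappa> \<Longrightarrow> a \<notin> underS \<kappa> b \<longleftrightarrow> (b, a) \<in> \<kappa>"
  using wo_rel.TOTALS[OF wo] wo_rel.REFL[OF wo] wo_rel.ANTISYM[OF wo]
  unfolding underS_def refl_on_def antisym_def by blast

lemma ex_greater: "a \<in> Field \<kappa> \<Longrightarrow> \<exists>b\<in>Field \<kappa>. a \<in> underS \<kappa> b"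
  using infinite_Card_order_limit[OF card infinite] unfolding underS_def by fastforce

lemma underS_trans: "a \<in> underS \<kappa> b \<Longrightarrow> (b, c) \<in> \<kappa> \<Longrightarrow> a \<in> underS \<kappa> c"
  using wo_rel.TRANS[OF wo] wo_rel.ANTISYM[OF wo]
  unfolding underS_def trans_def antisym_def by blast

lemma underS_mono: "(b, c) \<in> \<kappa> \<Longrightarrow> underS \<kappa> b \<subseteq> underS \<kappa> c"
  using underS_trans by blast

lemma under_subset_underS: "b \<in> underS \<kappa> c \<Longrightarrow> under \<kappa> b \<subseteq> underS \<kappa> c"
  using wo_rel.TRANS[OF wo] wo_rel.ANTISYM[OF wo]
  unfolding underS_def under_def trans_def antisym_def by blast

lemma card_under:
  assumes "a \<in> Field \<kappa>"
  shows "|under \<kappa> a| <o \<kappa>"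
proof -
  obtain b where "b \<in> Field \<kappa>" "a \<in> underS \<kappa> b" using ex_greater[OF assms] by blast
  then show ?thesis
    using under_subset_underS card_of_underS[OF card] card_of_mono1 ordLeq_ordLess_trans by metis
qed

text \<open>The first index at which a point leaves the sequence \<open>C\<close> is not constant modulo \<open>V\<close>, so the
  p-point property applies to it.\<close>

lemma p_point_pseudo_intersection:
  assumes V: "p_point \<kappa> V" and C: "\<And>\<gamma>. \<gamma> \<in> Field \<kappa> \<Longrightarrow> C \<gamma> \<in> V"
  shows "\<exists>X\<in>V. \<forall>\<gamma>\<in>Field \<kappa>. bounded_in \<kappa> (X - C \<gamma>)"
proof -
  have U: "ultrafilter_over (Field \<kappa>) V" using V by (simp add: p_point_def)
  define E where "E = Field \<kappa> \<inter> (\<Inter>\<gamma>\<in>Field \<kappa>. C \<gamma>)"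
  have E: "E \<subseteq> Field \<kappa>" unfolding E_def by auto
  obtain z where z: "z \<in> Field \<kappa>" using infinite by fastforce
  show ?thesis
  proof (cases "E \<in> V")
    case True
    have "bounded_in \<kappa> (E - C \<gamma>)" if "\<gamma> \<in> Field \<kappa>" for \<gamma>
      using that z unfolding E_def bounded_in_def by auto
    with True show ?thesis by auto
  next
    case False
    then have nE: "Field \<kappa> - E \<in> V" using ultrafilter_cases[OF U E] by auto
    \<comment> \<open>On \<open>E\<close> there is no first index; the default \<open>z\<close> only
      keeps the values inside \<kappa>, and \<open>E\<close> is not in \<open>V\<close>.\<close>
    define f where "f x = (if x \<in> E then z else wo_rel.minim \<kappa> {\<gamma> \<in> Field \<kappa>. x \<notin> C \<gamma>})" for x
    have f: "f x \<in> Field \<kappa>" "x \<notin> C (f x)" "\<And>\<gamma>. \<gamma> \<in> Field \<kappa> \<Longrightarrow> x \<notin> C \<gamma> \<Longrightarrow> (f x, \<gamma>) \<in> \<kappa>"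
      if "x \<in> Field \<kappa> - E" for x
    proof -
      have ne: "{\<gamma> \<in> Field \<kappa>. x \<notin> C \<gamma>} \<noteq> {}" and sub: "{\<gamma> \<in> Field \<kappa>. x \<notin> C \<gamma>} \<subseteq> Field \<kappa>"
        using that unfolding E_def by auto
      show "f x \<in> Field \<kappa>" "x \<notin> C (f x)"
        using wo_rel.minim_in[OF wo sub ne] that unfolding f_def by auto
      show "(f x, \<gamma>) \<in> \<kappa>" if "\<gamma> \<in> Field \<kappa>" "x \<notin> C \<gamma>" for \<gamma>
        using wo_rel.minim_least[OF wo sub, of \<gamma>] that \<open>x \<in> Field \<kappa> - E\<close> unfolding f_def by auto
    qed
    have "f ` Field \<kappa> \<subseteq> Field \<kappa>" using f(1) z by (force simp: f_def)
    moreover have "\<not> constant_mod (Field \<kappa>) V f"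
    proof
      assume "constant_mod (Field \<kappa>) V f"
      then obtain c where c: "{x \<in> Field \<kappa>. f x = c} \<in> V" unfolding constant_mod_def by auto
      \<comment> \<open>The constant value is attained outside \<open>E\<close>, hence is a genuine
        index \<open>c\<close>. But the points outside \<open>E\<close> with this value all miss
        \<open>C c\<close>, a member of \<open>V\<close>.\<close>
      have "{x \<in> Field \<kappa>. f x = c} \<inter> (Field \<kappa> - E) \<noteq> {}"
        using ultrafilter_Int[OF U c nE] ultrafilter_empty[OF U] by metis
      with f(1) have "c \<in> Field \<kappa>" by auto
      from ultrafilter_Int[OF U ultrafilter_Int[OF U c nE] C[OF this]]
      have "{x \<in> Field \<kappa>. f x = c} \<inter> (Field \<kappa> - E) \<inter> C c \<in> V" .
      moreover have "{x \<in> Field \<kappa>. f x = c} \<inter> (Field \<kappa> - E) \<inter> C c = {}" using f(2) by auto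
      ultimately show False using ultrafilter_empty[OF U] by simp
    qed
    ultimately obtain X where X: "X \<in> V" "\<And>\<gamma>. \<gamma> \<in> Field \<kappa> \<Longrightarrow> bounded_in \<kappa> (f -` underS \<kappa> \<gamma> \<inter> X)"
      using V unfolding p_point_def by blast
    have "bounded_in \<kappa> ((X \<inter> (Field \<kappa> - E)) - C \<gamma>)" if "\<gamma> \<in> Field \<kappa>" for \<gamma>
    proof -
      \<comment> \<open>Missing \<open>C \<gamma>\<close> gives only \<open>f x\<close> \<le>
        \<open>\<gamma>\<close>, while the p-point property speaks of strict initial segments; hence
        the larger \<open>\<delta>\<close>.\<close>
      obtain \<delta> where \<delta>: "\<delta> \<in> Field \<kappa>" "\<gamma> \<in> underS \<kappa> \<delta>"
        using ex_greater \<open>\<gamma> \<in> Field \<kappa>\<close> by blast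
      have "(X \<inter> (Field \<kappa> - E)) - C \<gamma> \<subseteq> f -` underS \<kappa> \<delta> \<inter> X"
        using f(3)[OF _ that] under_subset_underS[OF \<delta>(2)] unfolding under_def by auto
      with X(2)[OF \<delta>(1)] show ?thesis unfolding bounded_in_def by blast
    qed
    then show ?thesis using ultrafilter_Int[OF U X(1) nE] by auto
  qed
qed

text \<open>Call a class of indices with equal trace on \<open>T \<gamma>\<close> small if it has at
  most \<kappa> elements. There are at most \<kappa> traces for each \<open>\<gamma>\<close>, so the
  small classes for all \<open>\<gamma>\<close> together cover at most \<kappa> indices. Any
  remaining index works for every \<open>\<gamma>\<close> at once.\<close>

lemma pigeonhole_cardSuc:
  fixes E :: "'a set \<Rightarrow> 'c set" and T :: "'a \<Rightarrow> 'c set"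
  assumes T: "\<And>\<gamma>. \<gamma> \<in> Field \<kappa> \<Longrightarrow> |Pow (T \<gamma>)| \<le>o \<kappa>"
  shows "\<exists>i\<in>Field (cardSuc \<kappa>). \<forall>\<gamma>\<in>Field \<kappa>.
    \<not> |{j \<in> Field (cardSuc \<kappa>). E j \<inter> T \<gamma> = E i \<inter> T \<gamma>}| \<le>o \<kappa>"
proof (rule ccontr)
  let ?K = "Field (cardSuc \<kappa>)"
  define H where "H \<gamma> P = {j \<in> ?K. E j \<inter> T \<gamma> = P}" for \<gamma> P
  assume "\<not> ?thesis"
  then have bad: "\<exists>\<gamma>\<in>Field \<kappa>. |H \<gamma> (E i \<inter> T \<gamma>)| \<le>o \<kappa>" if "i \<in> ?K" for i
    using that unfolding H_def by blast
  define M where "M \<gamma> = (\<Union>P\<in>{P \<in> Pow (T \<gamma>). |H \<gamma> P| \<le>o \<kappa>}. H \<gamma> P)" for \<gamma>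
  have "|M \<gamma>| \<le>o \<kappa>" if "\<gamma> \<in> Field \<kappa>" for \<gamma>
    unfolding M_def
  proof (rule card_of_UNION_ordLeq_infinite_Field[OF infinite card])
    show "|{P \<in> Pow (T \<gamma>). |H \<gamma> P| \<le>o \<kappa>}| \<le>o \<kappa>"
      by (rule ordLeq_transitive[OF card_of_mono1 T[OF that]]) auto
  qed auto
  then have "|\<Union>\<gamma>\<in>Field \<kappa>. M \<gamma>| \<le>o \<kappa>"
    using card_of_Field_ordIso[OF card]
    by (intro card_of_UNION_ordLeq_infinite_Field[OF infinite card]) (auto intro: ordIso_imp_ordLeq)
  moreover have "?K \<subseteq> (\<Union>\<gamma>\<in>Field \<kappa>. M \<gamma>)"
  proof
    fix i assume i: "i \<in> ?K"
    from bad[OF i] obtain \<gamma> where "\<gamma> \<in> Field \<kappa>" "|H \<gamma> (E i \<inter> T \<gamma>)| \<le>o \<kappa>" by auto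
    moreover have "i \<in> H \<gamma> (E i \<inter> T \<gamma>)" using i unfolding H_def by auto
    ultimately show "i \<in> (\<Union>\<gamma>\<in>Field \<kappa>. M \<gamma>)" unfolding M_def by blast
  qed
  ultimately have "|?K| \<le>o \<kappa>" using card_of_mono1 ordLeq_transitive by blast
  then have "cardSuc \<kappa> \<le>o \<kappa>"
    using card_of_Field_ordIso[OF cardSuc_Card_order[OF card]]
      ordIso_ordLeq_trans ordIso_symmetric by blast
  then show False using cardSuc_greater[OF card] not_ordLess_ordLeq by blast
qed

text \<open>Recursion along \<kappa>: at stage \<open>\<gamma>\<close> fewer than \<kappa> values
  have been used, which cannot exhaust \<open>H \<gamma>\<close>.\<close>

lemma injective_choice:
  assumes H: "\<And>\<gamma>. \<gamma> \<in> Field \<kappa> \<Longrightarrow> \<not> |H \<gamma>| \<le>o \<kappa>"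
  shows "\<exists>j. inj_on j (Field \<kappa>) \<and> (\<forall>\<gamma>\<in>Field \<kappa>. j \<gamma> \<in> H \<gamma>)"
proof -
  have "\<exists>j. \<forall>\<gamma>. \<gamma> \<in> Field \<kappa> \<longrightarrow> j \<gamma> \<in> H \<gamma> - j ` underS \<kappa> \<gamma>"
  proof (rule dependent_wf_choice[OF wo_rel.WF[OF wo]])
    fix f g :: "'a \<Rightarrow> 'b" and \<gamma> r
    assume "\<And>z. (z, \<gamma>) \<in> \<kappa> - Id \<Longrightarrow> f z = g z"
    then have "f ` underS \<kappa> \<gamma> = g ` underS \<kappa> \<gamma>" unfolding underS_def by (auto simp: image_iff)
    then show "(\<gamma> \<in> Field \<kappa> \<longrightarrow> r \<in> H \<gamma> - f ` underS \<kappa> \<gamma>) = (\<gamma> \<in> Field \<kappa> \<longrightarrow> r \<in> H \<gamma> - g ` underS \<kappa> \<gamma>)"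
      by simp
  next
    fix \<gamma> and f :: "'a \<Rightarrow> 'b"
    have "H \<gamma> - f ` underS \<kappa> \<gamma> \<noteq> {}" if "\<gamma> \<in> Field \<kappa>"
    proof
      assume "H \<gamma> - f ` underS \<kappa> \<gamma> = {}"
      then have "|H \<gamma>| \<le>o |f ` underS \<kappa> \<gamma>|" by (intro card_of_mono1) auto
      also have "|f ` underS \<kappa> \<gamma>| \<le>o |underS \<kappa> \<gamma>|" by (rule card_of_image)
      also have "|underS \<kappa> \<gamma>| \<le>o \<kappa>" using card_of_underS[OF card that] ordLess_imp_ordLeq by blast
      finally show False using H[OF that] by simp
    qed
    then show "\<exists>r. \<gamma> \<in> Field \<kappa> \<longrightarrow> r \<in> H \<gamma> - f ` underS \<kappa> \<gamma>" by auto
  qed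
  then obtain j where j: "\<And>\<gamma>. \<gamma> \<in> Field \<kappa> \<Longrightarrow> j \<gamma> \<in> H \<gamma> - j ` underS \<kappa> \<gamma>" by blast
  have "inj_on j (Field \<kappa>)"
  proof (rule inj_onI, rule ccontr)
    fix x y assume xy: "x \<in> Field \<kappa>" "y \<in> Field \<kappa>" "j x = j y" "x \<noteq> y"
    then have "x \<in> underS \<kappa> y \<or> y \<in> underS \<kappa> x"
      using not_underS unfolding underS_def by blast
    with j xy show False by (metis DiffD2 imageI)
  qed
  with j show ?thesis by blast
qed

text \<open>By recursion \<open>a \<xi>\<close> is put above all earlier right endpoints
  \<open>G (a \<eta>)\<close>; regularity provides the room. The interval from
  \<open>a \<xi>\<close> to \<open>G (a \<xi>)\<close> is written as a difference of initial
  segments.\<close>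

lemma disjoint_intervals:
  assumes G: "\<And>\<gamma>. \<gamma> \<in> Field \<kappa> \<Longrightarrow> G \<gamma> \<in> Field \<kappa> \<and> \<gamma> \<in> underS \<kappa> (G \<gamma>)"
  shows "\<exists>a. a ` Field \<kappa> \<subseteq> Field \<kappa> \<and> inj_on a (Field \<kappa>) \<and>
    (\<forall>\<xi>\<in>Field \<kappa>. \<forall>\<eta>\<in>Field \<kappa>. \<xi> \<noteq> \<eta> \<longrightarrow>
      (underS \<kappa> (G (a \<xi>)) - underS \<kappa> (a \<xi>)) \<inter> (underS \<kappa> (G (a \<eta>)) - underS \<kappa> (a \<eta>)) = {})"
proof -
  have "\<exists>a. \<forall>\<xi>. \<xi> \<in> Field \<kappa> \<longrightarrow> a \<xi> \<in> Field \<kappa> \<and> (\<forall>\<eta>\<in>underS \<kappa> \<xi>. (G (a \<eta>), a \<xi>) \<in> \<kappa>)"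
  proof (rule dependent_wf_choice[OF wo_rel.WF[OF wo]])
    fix f g :: "'a \<Rightarrow> 'a" and \<xi> r
    assume "\<And>z. (z, \<xi>) \<in> \<kappa> - Id \<Longrightarrow> f z = g z"
    then have "\<forall>\<eta>\<in>underS \<kappa> \<xi>. f \<eta> = g \<eta>" unfolding underS_def by auto
    then show "(\<xi> \<in> Field \<kappa> \<longrightarrow> r \<in> Field \<kappa> \<and> (\<forall>\<eta>\<in>underS \<kappa> \<xi>. (G (f \<eta>), r) \<in> \<kappa>)) =
        (\<xi> \<in> Field \<kappa> \<longrightarrow> r \<in> Field \<kappa> \<and> (\<forall>\<eta>\<in>underS \<kappa> \<xi>. (G (g \<eta>), r) \<in> \<kappa>))"
      by simp
  next
    fix \<xi> and f :: "'a \<Rightarrow> 'a"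
    assume IH: "\<And>y. (y, \<xi>) \<in> \<kappa> - Id \<Longrightarrow> y \<in> Field \<kappa> \<longrightarrow>
      f y \<in> Field \<kappa> \<and> (\<forall>\<eta>\<in>underS \<kappa> y. (G (f \<eta>), f y) \<in> \<kappa>)"
    have "f \<eta> \<in> Field \<kappa>" if "\<eta> \<in> underS \<kappa> \<xi>" for \<eta>
      using IH[of \<eta>] that unfolding underS_def Field_def by auto
    then have "(\<lambda>\<eta>. G (f \<eta>)) ` underS \<kappa> \<xi> \<subseteq> Field \<kappa>" using G by auto
    then have "bounded_in \<kappa> ((\<lambda>\<eta>. G (f \<eta>)) ` underS \<kappa> \<xi>)" if "\<xi> \<in> Field \<kappa>"
      by (rule small_image_bounded[OF Order_Relation.underS_Field card_of_underS[OF card that]])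
    then show "\<exists>r. \<xi> \<in> Field \<kappa> \<longrightarrow> r \<in> Field \<kappa> \<and> (\<forall>\<eta>\<in>underS \<kappa> \<xi>. (G (f \<eta>), r) \<in> \<kappa>)"
      unfolding bounded_in_def image_subset_iff underS_def by blast
  qed
  then obtain a where a: "\<And>\<xi>. \<xi> \<in> Field \<kappa> \<Longrightarrow> a \<xi> \<in> Field \<kappa>"
    "\<And>\<xi> \<eta>. \<xi> \<in> Field \<kappa> \<Longrightarrow> \<eta> \<in> underS \<kappa> \<xi> \<Longrightarrow> (G (a \<eta>), a \<xi>) \<in> \<kappa>" by blast
  define D where "D \<xi> = underS \<kappa> (G (a \<xi>)) - underS \<kappa> (a \<xi>)" for \<xi>
  have less: "D \<eta> \<inter> D \<xi> = {}" if "\<xi> \<in> Field \<kappa>" "\<eta> \<in> underS \<kappa> \<xi>" for \<xi> \<eta>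
    using underS_mono[OF a(2)[OF that]] unfolding D_def by auto
  have disj: "D \<xi> \<inter> D \<eta> = {}" if "\<xi> \<in> Field \<kappa>" "\<eta> \<in> Field \<kappa>" "\<xi> \<noteq> \<eta>" for \<xi> \<eta>
  proof -
    from that have "\<xi> \<in> underS \<kappa> \<eta> \<or> \<eta> \<in> underS \<kappa> \<xi>"
      using not_underS unfolding underS_def by blast
    with less that show ?thesis by blast
  qed
  \<comment> \<open>The intervals are nonempty because \<open>G\<close> is strictly increasing its
    argument, so their disjointness makes \<open>a\<close> injective.\<close>
  have a_mem: "a \<xi> \<in> D \<xi>" if "\<xi> \<in> Field \<kappa>" for \<xi>
    using G[OF a(1)[OF that]] unfolding D_def underS_def by auto
  have "inj_on a (Field \<kappa>)"
  proof (rule inj_onI, rule ccontr)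
    fix \<xi> \<eta> assume *: "\<xi> \<in> Field \<kappa>" "\<eta> \<in> Field \<kappa>" "a \<xi> = a \<eta>" "\<xi> \<noteq> \<eta>"
    from a_mem[OF *(1)] a_mem[OF *(2)] *(3) have "a \<xi> \<in> D \<xi> \<inter> D \<eta>" by simp
    with disj[OF *(1,2,4)] show False by simp
  qed
  moreover have "a ` Field \<kappa> \<subseteq> Field \<kappa>" using a(1) by blast
  ultimately show ?thesis using disj unfolding D_def by (intro exI[of _ a] conjI ballI impI)
qed

text \<open>The classes are the slices of 3 \<times> \<kappa>, carried over by a bijection with
  \<kappa>.\<close>

lemma split_in_three:
  "\<exists>J :: nat \<Rightarrow> 'a set. (\<forall>c<3. J c \<subseteq> Field \<kappa> \<and> |J c| =o \<kappa>) \<and>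
    (\<forall>c<3. \<forall>d<3. c \<noteq> d \<longrightarrow> J c \<inter> J d = {})"
proof -
  have "|{..<3::nat}| \<le>o |Field \<kappa>|"
    using infinite card_of_ordLeq_infinite by (metis card_of_Well_order finite_lessThan ordLeq_total)
  then have "|{..<3::nat} \<times> Field \<kappa>| =o |Field \<kappa>|"
    using card_of_Times_infinite[OF infinite, of "{..<3::nat}"] by (auto simp: lessThan_empty_iff)
  then obtain p where p: "bij_betw p ({..<3::nat} \<times> Field \<kappa>) (Field \<kappa>)"
    unfolding card_of_ordIso[symmetric] by blast
  define J where "J c = p ` ({c} \<times> Field \<kappa>)" for c
  have "|J c| =o \<kappa>" if "c < 3" for c
  proof -
    have "bij_betw (\<lambda>x. p (c, x)) (Field \<kappa>) (J c)"
      using p that unfolding J_def bij_betw_def inj_on_def by auto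
    then have "|Field \<kappa>| =o |J c|" unfolding card_of_ordIso[symmetric] by blast
    then show ?thesis
      using card_of_Field_ordIso[OF card] ordIso_symmetric ordIso_transitive by blast
  qed
  moreover have "J c \<subseteq> Field \<kappa>" if "c < 3" for c
    using p that unfolding J_def bij_betw_def by auto
  moreover have "J c \<inter> J d = {}" if "c < 3" "d < 3" "c \<noteq> d" for c d
    using p that unfolding J_def bij_betw_def inj_on_def by auto
  ultimately show ?thesis by blast
qed


section \<open>The Galvin property of the sum for regular \<kappa>\<close>

lemma square_small:
  assumes "|T| <o \<kappa>"
  shows "|T \<times> T| <o \<kappa>"
proof (cases "finite T")
  case True
  then have "finite (Field ( |T \<times> T| ))" by (simp add: Field_card_of)
  then show ?thesis using finite_ordLess_infinite[OF card_of_Well_order _ _ infinite] wo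
    by (simp add: wo_rel_def)
next
  case False
  from ordIso_ordLess_trans[OF card_of_Times_same_infinite[OF False] assms] show ?thesis .
qed

text \<open>Transport along an injection into \<kappa>. The sets to be counted live in a sum type,
  whereas \<open>Pow_ordLeq\<close> speaks of subsets of \<kappa>.\<close>

lemma Pow_ordLeq_small:
  assumes "|T| <o \<kappa>"
  shows "|Pow T| \<le>o \<kappa>"
proof -
  have "|T| \<le>o |Field \<kappa>|"
    using assms card_of_Field_ordIso[OF card]
    by (meson ordIso_symmetric ordLess_imp_ordLeq ordLess_ordIso_trans)
  then obtain f where f: "inj_on f T" "f ` T \<subseteq> Field \<kappa>" unfolding card_of_ordLeq[symmetric] by blast
  have "|Pow T| \<le>o |Pow (f ` T)|"
    unfolding card_of_ordLeq[symmetric] using inj_on_image_Pow[OF f(1)] by blast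
  moreover have "|f ` T| <o \<kappa>" using card_of_image assms by (rule ordLeq_ordLess_trans)
  ultimately show ?thesis using Pow_ordLeq[OF f(2)] ordLeq_transitive by blast
qed

theorem galvin_property_sum:
  assumes U: "ultrafilter_over (Field \<kappa>) U" "p_point \<kappa> U"
    and V: "\<And>\<alpha>. \<alpha> \<in> Field \<kappa> \<Longrightarrow>
      ultrafilter_over (Field \<kappa>) (V \<alpha>) \<and> complete_filter \<kappa> (V \<alpha>) \<and> p_point \<kappa> (V \<alpha>)"
  shows "galvin_property \<kappa> (ultrafilter_sum (Field \<kappa>) U (\<lambda>_. Field \<kappa>) V)"
  unfolding galvin_property_def
proof (intro allI impI)
  let ?K = "Field \<kappa>" and ?S = "ultrafilter_sum (Field \<kappa>) U (\<lambda>_. Field \<kappa>) V"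
  let ?S' = "Field (cardSuc \<kappa>)"
  fix A :: "'a set \<Rightarrow> ('a \<times> 'a) set"
  assume A: "\<forall>i\<in>?S'. A i \<in> ?S"
  define sec where "sec i \<alpha> = {\<beta> \<in> ?K. (\<alpha>, \<beta>) \<in> A i}" for i \<alpha>
  define B where "B i = {\<alpha> \<in> ?K. sec i \<alpha> \<in> V \<alpha>}" for i
  have A_sub: "A i \<subseteq> ?K \<times> ?K" and B: "B i \<in> U" if "i \<in> ?S'" for i
    using A that unfolding ultrafilter_sum_def B_def sec_def by auto
  note Vu = V[THEN conjunct1] and Vc = V[THEN conjunct2, THEN conjunct1]
    and Vp = V[THEN conjunct2, THEN conjunct2]

  \<comment> \<open>The disjoint sum codes the square and the segment below \<open>\<gamma>\<close>
    together, so that one pigeonhole argument controls both \<open>A\<close> and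
    \<open>B\<close>.\<close>
  define T where "T \<gamma> = (underS \<kappa> \<gamma> \<times> underS \<kappa> \<gamma>) <+> underS \<kappa> \<gamma>" for \<gamma>
  have "|Pow (T \<gamma>)| \<le>o \<kappa>" if "\<gamma> \<in> ?K" for \<gamma>
    unfolding T_def using card_of_underS[OF card that]
    by (intro Pow_ordLeq_small card_of_Plus_ordLess_infinite_Field[OF infinite card]
        square_small)
  from pigeonhole_cardSuc[where T = T and E = "\<lambda>i. A i <+> B i", OF this] obtain i where i: "i \<in> ?S'"
    and H: "\<And>\<gamma>. \<gamma> \<in> ?K \<Longrightarrow> \<not> |{j \<in> ?S'. (A j <+> B j) \<inter> T \<gamma> = (A i <+> B i) \<inter> T \<gamma>}| \<le>o \<kappa>"
    by blast
  from injective_choice[where H = "\<lambda>\<gamma>. {j \<in> ?S'. (A j <+> B j) \<inter> T \<gamma> = (A i <+> B i) \<inter> T \<gamma>}", OF H]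
  obtain j where j: "inj_on j ?K"
    "\<And>\<gamma>. \<gamma> \<in> ?K \<Longrightarrow> j \<gamma> \<in> {j \<in> ?S'. (A j <+> B j) \<inter> T \<gamma> = (A i <+> B i) \<inter> T \<gamma>}" by blast
  have jS: "j \<gamma> \<in> ?S'" if "\<gamma> \<in> ?K" for \<gamma> using j(2)[OF that] by simp
  have agree: "Inl x \<in> T \<gamma> \<Longrightarrow> x \<in> A (j \<gamma>) \<longleftrightarrow> x \<in> A i"
    "Inr \<alpha> \<in> T \<gamma> \<Longrightarrow> \<alpha> \<in> B (j \<gamma>) \<longleftrightarrow> \<alpha> \<in> B i" if "\<gamma> \<in> ?K" for \<gamma> x \<alpha>
  proof -
    have eq_T: "(A (j \<gamma>) <+> B (j \<gamma>)) \<inter> T \<gamma> = (A i <+> B i) \<inter> T \<gamma>" using j(2)[OF that] by simp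
    show "x \<in> A (j \<gamma>) \<longleftrightarrow> x \<in> A i" if "Inl x \<in> T \<gamma>"
    proof -
      have "Inl x \<in> A (j \<gamma>) <+> B (j \<gamma>) \<longleftrightarrow> Inl x \<in> A i <+> B i"
        using that eq_T unfolding set_eq_iff by (metis IntD1 IntI)
      then show ?thesis by auto
    qed
    show "\<alpha> \<in> B (j \<gamma>) \<longleftrightarrow> \<alpha> \<in> B i" if "Inr \<alpha> \<in> T \<gamma>"
    proof -
      have "Inr \<alpha> \<in> A (j \<gamma>) <+> B (j \<gamma>) \<longleftrightarrow> Inr \<alpha> \<in> A i <+> B i"
        using that eq_T unfolding set_eq_iff by (metis IntD1 IntI)
      then show ?thesis by auto
    qed
  qed
  have agree_A: "(\<alpha>, \<beta>) \<in> A (j \<gamma>) \<longleftrightarrow> (\<alpha>, \<beta>) \<in> A i"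
    if "\<gamma> \<in> ?K" "\<alpha> \<in> underS \<kappa> \<gamma>" "\<beta> \<in> underS \<kappa> \<gamma>" for \<alpha> \<beta> \<gamma>
    using agree(1)[OF that(1), of "(\<alpha>, \<beta>)"] that unfolding T_def by auto
  have agree_B: "\<alpha> \<in> B (j \<gamma>) \<longleftrightarrow> \<alpha> \<in> B i" if "\<gamma> \<in> ?K" "\<alpha> \<in> underS \<kappa> \<gamma>" for \<alpha> \<gamma>
    using agree(2)[OF that(1), of \<alpha>] that unfolding T_def by auto

  from p_point_pseudo_intersection[OF U(2), of "\<lambda>\<gamma>. B (j \<gamma>)", OF B[OF jS]]
  obtain X where X: "X \<in> U" "\<And>\<gamma>. \<gamma> \<in> ?K \<Longrightarrow> bounded_in \<kappa> (X - B (j \<gamma>))" by blast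
  then obtain h where h: "\<And>\<gamma>. \<gamma> \<in> ?K \<Longrightarrow> h \<gamma> \<in> ?K \<and> X - B (j \<gamma>) \<subseteq> underS \<kappa> (h \<gamma>)"
    unfolding bounded_in_def by metis
  \<comment> \<open>For \<open>\<alpha>\<close> < \<open>\<gamma>\<close>, agreement of
    \<open>B (j \<gamma>)\<close> with \<open>B i\<close> puts the section in
    \<open>V \<alpha>\<close>. For other \<open>\<gamma>\<close> this may fail, so the whole space
    takes its place.\<close>
  have "\<exists>Y\<in>V \<alpha>. \<forall>\<gamma>\<in>?K. bounded_in \<kappa> (Y - (if \<alpha> \<in> underS \<kappa> \<gamma> then sec (j \<gamma>) \<alpha> else ?K))"
    if "\<alpha> \<in> B i" for \<alpha>
  proof (rule p_point_pseudo_intersection)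
    have \<alpha>: "\<alpha> \<in> ?K" using that unfolding B_def by auto
    show "p_point \<kappa> (V \<alpha>)" using Vp[OF \<alpha>] .
    show "(if \<alpha> \<in> underS \<kappa> \<gamma> then sec (j \<gamma>) \<alpha> else ?K) \<in> V \<alpha>" if "\<gamma> \<in> ?K" for \<gamma>
      using agree_B[OF that, of \<alpha>] \<open>\<alpha> \<in> B i\<close> ultrafilter_space[OF Vu[OF \<alpha>]] unfolding B_def by auto
  qed
  then obtain Y where Y: "\<And>\<alpha>. \<alpha> \<in> B i \<Longrightarrow> Y \<alpha> \<in> V \<alpha>"
    and "\<And>\<alpha> \<gamma>. \<alpha> \<in> B i \<Longrightarrow> \<gamma> \<in> ?K \<Longrightarrow>
      bounded_in \<kappa> (Y \<alpha> - (if \<alpha> \<in> underS \<kappa> \<gamma> then sec (j \<gamma>) \<alpha> else ?K))" by metis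
  then obtain g where g: "\<And>\<alpha> \<gamma>. \<alpha> \<in> B i \<Longrightarrow> \<gamma> \<in> ?K \<Longrightarrow> g \<alpha> \<gamma> \<in> ?K \<and>
      Y \<alpha> - (if \<alpha> \<in> underS \<kappa> \<gamma> then sec (j \<gamma>) \<alpha> else ?K) \<subseteq> underS \<kappa> (g \<alpha> \<gamma>)"
    unfolding bounded_in_def by metis
  \<comment> \<open>One bound for \<open>h \<gamma>\<close> and all
    \<open>g \<alpha> \<gamma>\<close> with \<open>\<alpha>\<close> < \<open>\<gamma>\<close>. These
    are fewer than \<kappa> values, so regularity applies.\<close>
  have "\<exists>\<delta>\<in>?K. \<gamma> \<in> underS \<kappa> \<delta> \<and> (h \<gamma>, \<delta>) \<in> \<kappa> \<and> (\<forall>\<alpha>\<in>underS \<kappa> \<gamma> \<inter> B i. (g \<alpha> \<gamma>, \<delta>) \<in> \<kappa>)"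
    if \<gamma>: "\<gamma> \<in> ?K" for \<gamma>
  proof -
    have "|underS \<kappa> \<gamma> \<inter> B i| <o \<kappa>"
      using card_of_mono1 card_of_underS[OF card \<gamma>] by (rule ordLeq_ordLess_trans) auto
    moreover have "underS \<kappa> \<gamma> \<inter> B i \<subseteq> ?K" unfolding B_def by auto
    moreover have "(\<lambda>\<alpha>. g \<alpha> \<gamma>) ` (underS \<kappa> \<gamma> \<inter> B i) \<subseteq> ?K" using g \<gamma> by auto
    ultimately have "bounded_in \<kappa> ((\<lambda>\<alpha>. g \<alpha> \<gamma>) ` (underS \<kappa> \<gamma> \<inter> B i))"
      using small_image_bounded by blast
    then obtain a where a: "a \<in> ?K" "\<And>\<alpha>. \<alpha> \<in> underS \<kappa> \<gamma> \<inter> B i \<Longrightarrow> (g \<alpha> \<gamma>, a) \<in> \<kappa>"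
      unfolding bounded_in_def underS_def by blast
    have max: "\<exists>c\<in>?K. (a, c) \<in> \<kappa> \<and> (b, c) \<in> \<kappa>" if "a \<in> ?K" "b \<in> ?K" for a b
      using that wo_rel.TOTALS[OF wo] wo_rel.REFL[OF wo] unfolding refl_on_def by blast
    obtain b where b: "b \<in> ?K" "(a, b) \<in> \<kappa>" "(h \<gamma>, b) \<in> \<kappa>" using max[OF a(1)] h[OF \<gamma>] by blast
    obtain c where c: "c \<in> ?K" "\<gamma> \<in> underS \<kappa> c" using ex_greater[OF \<gamma>] by blast
    obtain d where d: "d \<in> ?K" "(b, d) \<in> \<kappa>" "(c, d) \<in> \<kappa>" using max[OF b(1) c(1)] by blast
    have "(h \<gamma>, d) \<in> \<kappa>" "\<forall>\<alpha>\<in>underS \<kappa> \<gamma> \<inter> B i. (g \<alpha> \<gamma>, d) \<in> \<kappa>"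
      using a(2) b d(2) transD[OF wo_rel.TRANS[OF wo]] by blast+
    with d(1) underS_trans[OF c(2) d(3)] show ?thesis by blast
  qed
  then obtain G where G: "\<And>\<gamma>. \<gamma> \<in> ?K \<Longrightarrow> G \<gamma> \<in> ?K \<and> \<gamma> \<in> underS \<kappa> (G \<gamma>)"
    and Gh: "\<And>\<gamma>. \<gamma> \<in> ?K \<Longrightarrow> (h \<gamma>, G \<gamma>) \<in> \<kappa>"
    and Gg: "\<And>\<alpha> \<gamma>. \<gamma> \<in> ?K \<Longrightarrow> \<alpha> \<in> underS \<kappa> \<gamma> \<Longrightarrow> \<alpha> \<in> B i \<Longrightarrow> (g \<alpha> \<gamma>, G \<gamma>) \<in> \<kappa>"
    by (metis IntI)

  from disjoint_intervals[where G = G, OF G] obtain a where a: "a ` ?K \<subseteq> ?K" "inj_on a ?K"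
    and disj: "\<And>\<xi> \<eta>. \<xi> \<in> ?K \<Longrightarrow> \<eta> \<in> ?K \<Longrightarrow> \<xi> \<noteq> \<eta> \<Longrightarrow>
      (underS \<kappa> (G (a \<xi>)) - underS \<kappa> (a \<xi>)) \<inter> (underS \<kappa> (G (a \<eta>)) - underS \<kappa> (a \<eta>)) = {}" by metis
  from split_in_three obtain J :: "nat \<Rightarrow> 'a set"
    where J: "\<And>c. c < 3 \<Longrightarrow> J c \<subseteq> ?K" "\<And>c. c < 3 \<Longrightarrow> |J c| =o \<kappa>"
      "\<And>c d. c < 3 \<Longrightarrow> d < 3 \<Longrightarrow> c \<noteq> d \<Longrightarrow> J c \<inter> J d = {}" by metis
  define D where "D c = (\<Union>\<xi>\<in>J c. underS \<kappa> (G (a \<xi>)) - underS \<kappa> (a \<xi>))" for c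
  have D_sub: "D c \<subseteq> ?K" for c unfolding D_def using underS_Field by fastforce
  have D_disj: "D c \<inter> D d = {}" if cd: "c < 3" "d < 3" "c \<noteq> d" for c d
  proof (rule ccontr)
    assume "D c \<inter> D d \<noteq> {}"
    then obtain x \<xi> \<eta> where x: "\<xi> \<in> J c" "\<eta> \<in> J d"
      "x \<in> (underS \<kappa> (G (a \<xi>)) - underS \<kappa> (a \<xi>)) \<inter> (underS \<kappa> (G (a \<eta>)) - underS \<kappa> (a \<eta>))"
      unfolding D_def by blast
    then have "\<xi> \<noteq> \<eta>" using J(3)[OF cd] by blast
    with disj x J(1) cd show False by blast
  qed
  \<comment> \<open>At most one of the three disjoint sets is in \<open>U\<close>, and \<open>U\<close>-almost all \<open>V \<alpha>\<close> agree on the at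
    most one that they contain.\<close>
  have "\<exists>c<3. D c \<notin> U \<and> {\<alpha> \<in> ?K. D c \<in> V \<alpha>} \<notin> U"
  proof (rule ccontr)
    assume "\<not> ?thesis"
    then have bad: "D c \<in> U \<or> {\<alpha> \<in> ?K. D c \<in> V \<alpha>} \<in> U" if "c < 3" for c using that by blast
    have *: "\<not> (D c \<in> U \<and> D d \<in> U)" "\<not> ({\<alpha> \<in> ?K. D c \<in> V \<alpha>} \<in> U \<and> {\<alpha> \<in> ?K. D d \<in> V \<alpha>} \<in> U)"
      if "c < 3" "d < 3" "c \<noteq> d" for c d
    proof -
      show "\<not> (D c \<in> U \<and> D d \<in> U)" using ultrafilter_disjoint[OF U(1)] D_disj[OF that] by blast
      have "{\<alpha> \<in> ?K. D c \<in> V \<alpha>} \<inter> {\<alpha> \<in> ?K. D d \<in> V \<alpha>} = {}"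
        using ultrafilter_disjoint[OF Vu] D_disj[OF that] by blast
      then show "\<not> ({\<alpha> \<in> ?K. D c \<in> V \<alpha>} \<in> U \<and> {\<alpha> \<in> ?K. D d \<in> V \<alpha>} \<in> U)"
        using ultrafilter_disjoint[OF U(1)] by blast
    qed
    show False using bad[of 0] bad[of 1] bad[of 2] *[of 0 1] *[of 0 2] *[of 1 2] by auto
  qed
  then obtain c where c: "c < 3" "D c \<notin> U" "{\<alpha> \<in> ?K. D c \<in> V \<alpha>} \<notin> U" by blast

  define I where "I = (\<lambda>\<xi>. j (a \<xi>)) ` J c"
  have "inj_on (j \<circ> a) ?K" using comp_inj_on[OF a(2) inj_on_subset[OF j(1) a(1)]] .
  then have "inj_on (\<lambda>\<xi>. j (a \<xi>)) (J c)"
    using inj_on_subset[OF _ J(1)[OF c(1)]] unfolding comp_def by blast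
  then have "bij_betw (\<lambda>\<xi>. j (a \<xi>)) (J c) I" unfolding I_def by (rule inj_on_imp_bij_betw)
  then have "|J c| =o |I|" unfolding card_of_ordIso[symmetric] by blast
  then have I_card: "|I| =o \<kappa>" using J(2)[OF c(1)] ordIso_symmetric ordIso_transitive by blast
  have I_sub: "I \<subseteq> ?S'" unfolding I_def using jS a(1) J(1)[OF c(1)] by blast
  \<comment> \<open>An empty \<open>I\<close> would make the intersection \<open>UNIV\<close>, which
    need not lie in the square of \<kappa>.\<close>
  have J_ne: "J c \<noteq> {}"
    using J(2)[OF c(1)] infinite card_of_ordIso_finite_Field[OF card] ordIso_symmetric by force

  define P where "P = X \<inter> B i \<inter> (?K - D c) \<inter> (?K - {\<alpha> \<in> ?K. D c \<in> V \<alpha>})"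
  have P: "P \<in> U"
    unfolding P_def
  proof (intro ultrafilter_Int[OF U(1)])
    show "X \<in> U" using X(1) .
    show "B i \<in> U" using B[OF i] .
    show "?K - D c \<in> U" using ultrafilter_cases[OF U(1) D_sub] c(2) by blast
    have "{\<alpha> \<in> ?K. D c \<in> V \<alpha>} \<subseteq> ?K" by blast
    from ultrafilter_cases[OF U(1) this] c(3) show "?K - {\<alpha> \<in> ?K. D c \<in> V \<alpha>} \<in> U" by blast
  qed
  have section_V: "{\<beta> \<in> ?K. (\<alpha>, \<beta>) \<in> (\<Inter>k\<in>I. A k)} \<in> V \<alpha>" if \<alpha>P: "\<alpha> \<in> P" for \<alpha>
  proof -
    have \<alpha>: "\<alpha> \<in> ?K" "\<alpha> \<in> X" "\<alpha> \<in> B i" "\<alpha> \<notin> D c" "D c \<notin> V \<alpha>" using \<alpha>P unfolding P_def by auto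
    \<comment> \<open>These are the indices at or below \<open>\<alpha>\<close> whose section at
      \<open>\<alpha>\<close> is in \<open>V \<alpha>\<close>. There are fewer than \<kappa> of
      them, so completeness yields the set \<open>N\<close> below.\<close>
    define L where "L = {\<gamma> \<in> under \<kappa> \<alpha>. \<alpha> \<in> B (j \<gamma>)}"
    have L: "|L| <o \<kappa>"
      using card_of_mono1 card_under[OF \<alpha>(1)] by (rule ordLeq_ordLess_trans) (auto simp: L_def)
    define N where "N = ?K \<inter> (\<Inter>\<gamma>\<in>L. sec (j \<gamma>) \<alpha>)"
    define Q where "Q = Y \<alpha> \<inter> sec i \<alpha> \<inter> (?K - D c) \<inter> N"
    have "Q \<in> V \<alpha>"
      unfolding Q_def
    proof (intro ultrafilter_Int[OF Vu[OF \<alpha>(1)]])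
      show "Y \<alpha> \<in> V \<alpha>" using Y[OF \<alpha>(3)] .
      show "sec i \<alpha> \<in> V \<alpha>" using \<alpha>(3) unfolding B_def by auto
      show "?K - D c \<in> V \<alpha>" using ultrafilter_cases[OF Vu[OF \<alpha>(1)] D_sub] \<alpha>(5) by blast
      show "N \<in> V \<alpha>"
        unfolding N_def by (rule complete_filter_INT[OF Vu[OF \<alpha>(1)] Vc[OF \<alpha>(1)] L]) (auto simp: L_def B_def)
    qed
    moreover have "Q \<subseteq> {\<beta> \<in> ?K. (\<alpha>, \<beta>) \<in> (\<Inter>k\<in>I. A k)}"
    proof
      fix \<beta> assume "\<beta> \<in> Q"
      then have \<beta>: "\<beta> \<in> ?K" "\<beta> \<in> Y \<alpha>" "(\<alpha>, \<beta>) \<in> A i" "\<beta> \<notin> D c"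
        "\<And>\<gamma>. \<gamma> \<in> L \<Longrightarrow> (\<alpha>, \<beta>) \<in> A (j \<gamma>)" unfolding Q_def N_def sec_def by auto
      have "(\<alpha>, \<beta>) \<in> A (j (a \<xi>))" if \<xi>: "\<xi> \<in> J c" for \<xi>
      proof -
        let ?\<gamma> = "a \<xi>"
        have \<gamma>: "?\<gamma> \<in> ?K" using \<xi> J(1)[OF c(1)] a(1) by blast
        \<comment> \<open>A coordinate outside \<open>D c\<close> cannot lie between
          \<open>a \<xi>\<close> and \<open>G (a \<xi>)\<close>: once it is at least
          \<open>a \<xi>\<close>, it is at least \<open>G (a \<xi>)\<close>.\<close>
        have avoid: "x \<in> underS \<kappa> ?\<gamma>" if "x \<notin> D c" "x \<in> underS \<kappa> (G ?\<gamma>)" for x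
          using that \<xi> unfolding D_def by blast
        \<comment> \<open>If both coordinates are below \<open>a \<xi>\<close>, agreement with
          \<open>A i\<close> decides. If only \<open>\<alpha>\<close> is, then
          \<open>\<beta>\<close> is past the bound \<open>g\<close> and membership in
          \<open>Y \<alpha>\<close> decides. Otherwise \<open>\<alpha>\<close> is past the bound
          \<open>h\<close>, so \<open>a \<xi>\<close> belongs to \<open>L\<close>.\<close>
        show ?thesis
        proof (cases "\<alpha> \<in> underS \<kappa> ?\<gamma>")
          case \<alpha>\<gamma>: True
          show ?thesis
          proof (cases "\<beta> \<in> underS \<kappa> ?\<gamma>")
            case True
            then show ?thesis using agree_A[OF \<gamma> \<alpha>\<gamma>] \<beta>(3) by simp
          next
            case False
            then have "\<beta> \<notin> underS \<kappa> (G ?\<gamma>)" using avoid \<beta>(4) by blast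
            then have "\<beta> \<notin> underS \<kappa> (g \<alpha> ?\<gamma>)" using underS_mono[OF Gg[OF \<gamma> \<alpha>\<gamma> \<alpha>(3)]] by blast
            then have "\<beta> \<in> sec (j ?\<gamma>) \<alpha>" using g[OF \<alpha>(3) \<gamma>] \<beta>(2) \<alpha>\<gamma> by auto
            then show ?thesis unfolding sec_def by simp
          qed
        next
          case False
          then have "\<alpha> \<notin> underS \<kappa> (G ?\<gamma>)" using avoid \<alpha>(4) by blast
          then have "\<alpha> \<notin> underS \<kappa> (h ?\<gamma>)" using underS_mono[OF Gh[OF \<gamma>]] by blast
          then have "\<alpha> \<in> B (j ?\<gamma>)" using h[OF \<gamma>] \<alpha>(2) by blast
          moreover have "?\<gamma> \<in> under \<kappa> \<alpha>" using False not_underS[OF \<alpha>(1) \<gamma>] unfolding under_def by simp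
          ultimately show ?thesis using \<beta>(5) unfolding L_def by simp
        qed
      qed
      then show "\<beta> \<in> {\<beta> \<in> ?K. (\<alpha>, \<beta>) \<in> (\<Inter>k\<in>I. A k)}" using \<beta>(1) unfolding I_def by auto
    qed
    ultimately show ?thesis using ultrafilter_mono[OF Vu[OF \<alpha>(1)]] by (metis (no_types, lifting) mem_Collect_eq subsetI)
  qed
  have "P \<subseteq> {\<alpha> \<in> ?K. {\<beta> \<in> ?K. (\<alpha>, \<beta>) \<in> (\<Inter>k\<in>I. A k)} \<in> V \<alpha>}"
    using section_V unfolding P_def by blast
  with P have "{\<alpha> \<in> ?K. {\<beta> \<in> ?K. (\<alpha>, \<beta>) \<in> (\<Inter>k\<in>I. A k)} \<in> V \<alpha>} \<in> U"
    using ultrafilter_mono[OF U(1)] by (metis (no_types, lifting) mem_Collect_eq subsetI)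
  moreover have "(\<Inter>k\<in>I. A k) \<subseteq> ?K \<times> ?K" using A_sub I_sub J_ne unfolding I_def by fast
  ultimately have "(\<Inter>k\<in>I. A k) \<in> ?S" unfolding ultrafilter_sum_def by blast
  with I_sub I_card show "\<exists>I\<subseteq>?S'. |I| =o \<kappa> \<and> (\<Inter>i\<in>I. A i) \<in> ?S" by blast
qed

end

section \<open>Principal sums and transfer along the Rudin-Keisler order\<close>

lemma galvin_property_principal_sum:
  assumes card: "Card_order \<kappa>" and x: "x \<in> Field \<kappa>" "{x} \<in> U"
    and U: "ultrafilter_over (Field \<kappa>) U"
    and y: "{y} \<in> V x" and V: "ultrafilter_over (Field \<kappa>) (V x)"
  shows "galvin_property \<kappa> (ultrafilter_sum (Field \<kappa>) U (\<lambda>_. Field \<kappa>) V)"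
  unfolding galvin_property_def
proof (intro allI impI)
  let ?S = "ultrafilter_sum (Field \<kappa>) U (\<lambda>_. Field \<kappa>) V"
  fix A assume A: "\<forall>i\<in>Field (cardSuc \<kappa>). A i \<in> ?S"
  \<comment> \<open>Every member of \<open>U\<close> meets \<open>{x}\<close> and every member of
    \<open>V x\<close> meets \<open>{y}\<close>, so all \<open>A i\<close> share the pair
    \<open>(x, y)\<close>. Hence any \<kappa> many indices will do.\<close>
  have mem: "(x, y) \<in> A i" if "i \<in> Field (cardSuc \<kappa>)" for i
  proof -
    have *: "{\<alpha> \<in> Field \<kappa>. {\<beta> \<in> Field \<kappa>. (\<alpha>, \<beta>) \<in> A i} \<in> V \<alpha>} \<in> U"
      using A that unfolding ultrafilter_sum_def by blast
    have "{\<beta> \<in> Field \<kappa>. (x, \<beta>) \<in> A i} \<in> V x"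
      using ultrafilter_disjoint[OF U x(2), of "{\<alpha> \<in> Field \<kappa>. {\<beta> \<in> Field \<kappa>. (\<alpha>, \<beta>) \<in> A i} \<in> V \<alpha>}"] *
      by blast
    then show ?thesis
      using ultrafilter_disjoint[OF V y, of "{\<beta> \<in> Field \<kappa>. (x, \<beta>) \<in> A i}"] by blast
  qed
  have "\<kappa> \<le>o |Field (cardSuc \<kappa>)|"
    using cardSuc_ordLeq[OF card] card_of_Field_ordIso[OF cardSuc_Card_order[OF card]]
      ordIso_symmetric ordLeq_ordIso_trans by blast
  then have "|Field \<kappa>| \<le>o |Field (cardSuc \<kappa>)|"
    using card_of_Field_ordIso[OF card] ordIso_ordLeq_trans by blast
  then obtain f where f: "inj_on f (Field \<kappa>)" "f ` Field \<kappa> \<subseteq> Field (cardSuc \<kappa>)"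
    unfolding card_of_ordLeq[symmetric] by blast
  let ?I = "f ` Field \<kappa>"
  have "|Field \<kappa>| =o |?I|"
    using inj_on_imp_bij_betw[OF f(1)] unfolding card_of_ordIso[symmetric] by blast
  then have "|?I| =o \<kappa>"
    using card_of_Field_ordIso[OF card] ordIso_symmetric ordIso_transitive by blast
  moreover have "(\<Inter>i\<in>?I. A i) \<in> ?S"
  proof -
    have "(\<Inter>i\<in>?I. A i) \<subseteq> Field \<kappa> \<times> Field \<kappa>"
      using A f(2) x(1) unfolding ultrafilter_sum_def by fast
    moreover have y': "y \<in> Field \<kappa>" using ultrafilter_subset[OF V y] by simp
    have "{y} \<subseteq> {\<beta> \<in> Field \<kappa>. (x, \<beta>) \<in> (\<Inter>i\<in>?I. A i)}" using mem f(2) y' by auto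
    then have "{\<beta> \<in> Field \<kappa>. (x, \<beta>) \<in> (\<Inter>i\<in>?I. A i)} \<in> V x"
      by (rule ultrafilter_mono[OF V y]) auto
    then have "{x} \<subseteq> {\<alpha> \<in> Field \<kappa>. {\<beta> \<in> Field \<kappa>. (\<alpha>, \<beta>) \<in> (\<Inter>i\<in>?I. A i)} \<in> V \<alpha>}" using x(1) by blast
    then have "{\<alpha> \<in> Field \<kappa>. {\<beta> \<in> Field \<kappa>. (\<alpha>, \<beta>) \<in> (\<Inter>i\<in>?I. A i)} \<in> V \<alpha>} \<in> U"
      by (rule ultrafilter_mono[OF U x(2)]) auto
    ultimately show ?thesis unfolding ultrafilter_sum_def by blast
  qed
  ultimately show "\<exists>I\<subseteq>Field (cardSuc \<kappa>). |I| =o \<kappa> \<and> (\<Inter>i\<in>I. A i) \<in> ?S" using f(2) by blast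
qed

text \<open>The preimages of the \<open>A i\<close> under the projection are in \<open>S\<close>,
  and preimages commute with intersections over nonempty index sets.\<close>

lemma galvin_property_RK_le:
  assumes ne: "Field \<kappa> \<noteq> {}" and card: "Card_order \<kappa>"
    and S: "galvin_property \<kappa> S" and le: "RK_le Z W X S"
  shows "galvin_property \<kappa> W"
  unfolding galvin_property_def
proof (intro allI impI)
  from le obtain \<pi> where W: "W = {B. B \<subseteq> Z \<and> {x \<in> X. \<pi> x \<in> B} \<in> S}" unfolding RK_le_def by blast
  fix A assume A: "\<forall>i\<in>Field (cardSuc \<kappa>). A i \<in> W"
  then have "\<forall>i\<in>Field (cardSuc \<kappa>). {x \<in> X. \<pi> x \<in> A i} \<in> S" unfolding W by blast
  with S obtain I where I: "I \<subseteq> Field (cardSuc \<kappa>)" "|I| =o \<kappa>" "(\<Inter>i\<in>I. {x \<in> X. \<pi> x \<in> A i}) \<in> S"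
    unfolding galvin_property_def by (elim allE[of _ "\<lambda>i. {x \<in> X. \<pi> x \<in> A i}"]) blast
  \<comment> \<open>This is where \<kappa> being nonzero enters: over an empty \<open>I\<close> the
    intersection would be \<open>UNIV\<close>, which need not lie in \<open>Z\<close>.\<close>
  have "I \<noteq> {}"
  proof
    assume "I = {}"
    with I(2) have "|Field \<kappa>| =o |{} :: 'a set set|"
      using card_of_Field_ordIso[OF card] ordIso_symmetric ordIso_transitive by blast
    with ne show False using card_of_empty2 by blast
  qed
  then have "(\<Inter>i\<in>I. {x \<in> X. \<pi> x \<in> A i}) = {x \<in> X. \<pi> x \<in> (\<Inter>i\<in>I. A i)}" by auto
  moreover have "(\<Inter>i\<in>I. A i) \<subseteq> Z" using A I(1) \<open>I \<noteq> {}\<close> unfolding W by blast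
  ultimately have "(\<Inter>i\<in>I. A i) \<in> W" using I(3) unfolding W by simp
  with I show "\<exists>I\<subseteq>Field (cardSuc \<kappa>). |I| =o \<kappa> \<and> (\<Inter>i\<in>I. A i) \<in> W" by blast
qed

theorem theorem2p7:
  fixes \<kappa> :: "'a rel"
    and U :: "'a set set"
    and V :: "'a \<Rightarrow> 'a set set"
    and Z :: "'b set"
    and W :: "'b set set"
  assumes "Card_order \<kappa>"
    and "ultrafilter_over (Field \<kappa>) U" and "complete_filter \<kappa> U" and "p_point \<kappa> U"
    and "\<And>\<alpha>. \<alpha> \<in> Field \<kappa> \<Longrightarrow>
           ultrafilter_over (Field \<kappa>) (V \<alpha>) \<and> complete_filter \<kappa> (V \<alpha>) \<and> p_point \<kappa> (V \<alpha>)"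
    and "ultrafilter_over Z W"
    and "RK_equiv Z W (Field \<kappa> \<times> Field \<kappa>) (ultrafilter_sum (Field \<kappa>) U (\<lambda>_. Field \<kappa>) V)"
  shows "galvin_property \<kappa> W"
proof -
  let ?S = "ultrafilter_sum (Field \<kappa>) U (\<lambda>_. Field \<kappa>) V"
  have ne: "Field \<kappa> \<noteq> {}"
    using ultrafilter_space[OF assms(2)] ultrafilter_empty[OF assms(2)] by metis
  have "galvin_property \<kappa> ?S"
  proof (cases "strong_limit_regular \<kappa>")
    case True
    then show ?thesis using strong_limit_regular.galvin_property_sum assms(2,4,5) by blast
  next
    case False
    \<comment> \<open>When the locale fails, every complete ultrafilter over \<kappa> is principal:
      first \<open>U\<close>, at some \<open>x\<close>, and then \<open>V x\<close>.\<close>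
    then have "\<exists>x. {x} \<in> U"
      using nonprincipal_imp_strong_limit_regular[OF assms(1-3)] by blast
    then obtain x where x: "{x} \<in> U" "x \<in> Field \<kappa>" using ultrafilter_subset[OF assms(2)] by blast
    with False obtain y where "{y} \<in> V x"
      using nonprincipal_imp_strong_limit_regular[OF assms(1)] assms(5) by blast
    with x assms(1,2,5) show ?thesis by (blast intro: galvin_property_principal_sum)
  qed
  then show ?thesis
    using galvin_property_RK_le[OF ne assms(1)] assms(7) unfolding RK_equiv_def by blast
qed

end
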